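(* Let $\mathbf{G}=(G,\delta,\epsilon)$ be a comonad on a category $\mathcal{A}$, with comultiplication $\delta:G\Rightarrow GG$ and counit $\epsilon:G\Rightarrow \mathrm{Id}_{\mathcal{A}}$, and let $\mathbf{G}_\bullet$ be the associated simplicial endofunctor. Suppose $t:GG\Rightarrow GG$ is an invertible natural transformation such that for every object $M$ of $\mathcal{A}$: (i) $G(\epsilon_M)\circ t_M=\epsilon_{GM}$; (ii) $\epsilon_{GM}\circ t_M=G(\epsilon_M)$; (iii) $G(\delta_M)\circ t_M=t_{GM}\circ G(t_M)\circ\delta_{GM}$; (iv) $\delta_{GM}\circ t_M=t_{GM}\circ G(t_M)\circ t_{GM}\circ G(t_M)\circ G(\delta_M)$; (v) (quantum Yang–Baxter equation) $G(t_M)\circ t_{GM}\circ G(t_M)=t_{GM}\circ G(t_M)\circ t_{GM}$; (vi) $t_M\circ t_M\circ t_M\circ\delta_M=t_M\circ\delta_M$. For $n\ge 1$ define $t_n:G^{n+1}\Rightarrow G^{n+1}$ by $$t_{n,M}:=t_{G^{n-1}M}\circ G(t_{G^{n-2}M})\circ\cdots\circ G^{n-1}(t_M).$$ Then the $t_n$ are paracyclic operators on the augmented simplicial endofunctor $\mathbf{G}_\bullet\stackrel{\epsilon}{\Rightarrow}\mathrm{Id}_{\mathcal{A}}$, making it into an augmented paracyclic object in the category $\mathrm{End}\,\mathcal{A}$ of endofunctors of $\mathcal{A}$.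
   Context: A comonad on $\mathcal{A}$ is a triple $\mathbf{G}=(G,\delta,\epsilon)$ with $G:\mathcal{A}\to\mathcal{A}$ a functor and $\delta:G\Rightarrow G^2$, $\epsilon:G\Rightarrow \mathrm{Id}_{\mathcal{A}}$ natural transformations satisfying $\delta_{GM}\circ\delta_M=G(\delta_M)\circ\delta_M$ and $\epsilon_{GM}\circ\delta_M=G(\epsilon_M)\circ\delta_M=1_{GM}$ for all objects $M$. The associated simplicial endofunctor $\mathbf{G}_\bullet$ is the simplicial object in $\mathrm{End}\,\mathcal{A}$ with $\mathbf{G}_n=G^{n+1}$, faces $\partial_i=\partial_i^n=G^i(\epsilon_{G^{n-i}}):G^{n+1}\Rightarrow G^n$ and degeneracies $\sigma_i=\sigma_i^n=G^i(\delta_{G^{n-i}}):G^{n+1}\Rightarrow G^{n+2}$, $0\le i\le n$. It is augmented by $\epsilon:\mathbf{G}_0=G\Rightarrow \mathrm{Id}_{\mathcal{A}}$, meaning $\epsilon\circ\partial_0^1=\epsilon\circ\partial_1^1$. A paracyclic (synonym: $\mathbb{Z}$-cyclic) object in a category is a simplicial object $F_\bullet$ together with isomorphisms $t_n:F_n\to F_n$, $n\ge1$, such that (with the convention $t_0=\mathrm{id}$), for $n\ge1$ and $0<i\le n$: $$\partial_i t_n=t_{n-1}\partial_{i-1},\quad \sigma_i t_n=t_{n+1}\sigma_{i-1},\quad \partial_0t_n=\partial_n,\quad \sigma_0t_n=t_{n+1}^2\sigma_n.$$ The $t_n$ are called paracyclic operators. An augmented paracyclic object is a paracyclic object whose underlying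 simplicial object is equipped with an augmentation. *)

theory Defs
  imports "HOL-Library.FuncSet"
begin

section \<open>Categories, functors, natural transformations\<close>

record ('o, 'm) cat =
  Obj :: "'o set"
  Arr :: "'m set"
  Dom :: "'m \<Rightarrow> 'o"
  Cod :: "'m \<Rightarrow> 'o"
  Ident :: "'o \<Rightarrow> 'm"
  Comp :: "'m \<Rightarrow> 'm \<Rightarrow> 'm" (infixr "\<cdot>\<index>" 70)

definition Hom :: "('o, 'm) cat \<Rightarrow> 'o \<Rightarrow> 'o \<Rightarrow> 'm set" where
  "Hom C a b = {f \<in> Arr C. Dom C f = a \<and> Cod C f = b}"

locale category =
  fixes C :: "('o, 'm) cat" (structure)
  assumes dom_obj: "f \<in> Arr C \<Longrightarrow> Dom C f \<in> Obj C"
    and cod_obj: "f \<in> Arr C \<Longrightarrow> Cod C f \<in> Obj C"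
    and ident_hom: "a \<in> Obj C \<Longrightarrow> Ident C a \<in> Hom C a a"
    and comp_hom: "\<lbrakk>f \<in> Hom C a b; g \<in> Hom C b c\<rbrakk> \<Longrightarrow> g \<cdot> f \<in> Hom C a c"
    and ident_left: "f \<in> Hom C a b \<Longrightarrow> Ident C b \<cdot> f = f"
    and ident_right: "f \<in> Hom C a b \<Longrightarrow> f \<cdot> Ident C a = f"
    and comp_assoc: "\<lbrakk>f \<in> Hom C a b; g \<in> Hom C b c; h \<in> Hom C c d\<rbrakk>
      \<Longrightarrow> (h \<cdot> g) \<cdot> f = h \<cdot> (g \<cdot> f)"

definition is_iso :: "('o, 'm) cat \<Rightarrow> 'm \<Rightarrow> bool" where
  "is_iso C f \<longleftrightarrow> f \<in> Arr C \<and> (\<exists>g \<in> Hom C (Cod C f) (Dom C f).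
     g \<cdot>\<^bsub>C\<^esub> f = Ident C (Dom C f) \<and> f \<cdot>\<^bsub>C\<^esub> g = Ident C (Cod C f))"

text \<open>
  Object maps, arrow maps and families of components are required to be extensional
  (\<^const>\<open>undefined\<close> off their domain), so that HOL equality of functors and of natural
  transformations is equality of the underlying maps.
\<close>

record ('o, 'm, 'p, 'n) functor_data =
  fob :: "'o \<Rightarrow> 'p"
  far :: "'m \<Rightarrow> 'n"

definition is_functor ::
  "('o, 'm) cat \<Rightarrow> ('p, 'n) cat \<Rightarrow> ('o, 'm, 'p, 'n) functor_data \<Rightarrow> bool" where
  "is_functor C D F \<longleftrightarrow>
     fob F \<in> extensional (Obj C) \<and>
     far F \<in> extensional (Arr C) \<and>
     (\<forall>a \<in> Obj C. fob F a \<in> Obj D) \<and>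
     (\<forall>f \<in> Arr C. far F f \<in> Hom D (fob F (Dom C f)) (fob F (Cod C f))) \<and>
     (\<forall>a \<in> Obj C. far F (Ident C a) = Ident D (fob F a)) \<and>
     (\<forall>f \<in> Arr C. \<forall>g \<in> Arr C. Cod C f = Dom C g \<longrightarrow>
        far F (g \<cdot>\<^bsub>C\<^esub> f) = far F g \<cdot>\<^bsub>D\<^esub> far F f)"

definition id_functor :: "('o, 'm) cat \<Rightarrow> ('o, 'm, 'o, 'm) functor_data" where
  "id_functor C = \<lparr>fob = (\<lambda>a \<in> Obj C. a), far = (\<lambda>f \<in> Arr C. f)\<rparr>"

definition comp_functor :: "('o, 'm) cat \<Rightarrow> ('p, 'n, 'q, 'k) functor_data \<Rightarrow>
    ('o, 'm, 'p, 'n) functor_data \<Rightarrow> ('o, 'm, 'q, 'k) functor_data" where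
  "comp_functor C G F =
     \<lparr>fob = compose (Obj C) (fob G) (fob F), far = compose (Arr C) (far G) (far F)\<rparr>"

primrec pow_functor ::
  "('o, 'm) cat \<Rightarrow> ('o, 'm, 'o, 'm) functor_data \<Rightarrow> nat \<Rightarrow> ('o, 'm, 'o, 'm) functor_data" where
  "pow_functor C F 0 = id_functor C"
| "pow_functor C F (Suc n) = comp_functor C F (pow_functor C F n)"

record ('o, 'm, 'p, 'n) trans_data =
  src :: "('o, 'm, 'p, 'n) functor_data"
  trg :: "('o, 'm, 'p, 'n) functor_data"
  cmp :: "'o \<Rightarrow> 'n"

definition nat_trans ::
  "('o, 'm) cat \<Rightarrow> ('p, 'n) cat \<Rightarrow> ('o, 'm, 'p, 'n) trans_data \<Rightarrow> bool" where
  "nat_trans C D \<alpha> \<longleftrightarrow>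
     is_functor C D (src \<alpha>) \<and>
     is_functor C D (trg \<alpha>) \<and>
     cmp \<alpha> \<in> extensional (Obj C) \<and>
     (\<forall>a \<in> Obj C. cmp \<alpha> a \<in> Hom D (fob (src \<alpha>) a) (fob (trg \<alpha>) a)) \<and>
     (\<forall>f \<in> Arr C. cmp \<alpha> (Cod C f) \<cdot>\<^bsub>D\<^esub> far (src \<alpha>) f = far (trg \<alpha>) f \<cdot>\<^bsub>D\<^esub> cmp \<alpha> (Dom C f))"

definition functor_cat :: "('o, 'm) cat \<Rightarrow> ('p, 'n) cat \<Rightarrow>
    (('o, 'm, 'p, 'n) functor_data, ('o, 'm, 'p, 'n) trans_data) cat" where
  "functor_cat C D =
     \<lparr>Obj = {F. is_functor C D F},
      Arr = {\<alpha>. nat_trans C D \<alpha>},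
      Dom = src,
      Cod = trg,
      Ident = (\<lambda>F. \<lparr>src = F, trg = F, cmp = (\<lambda>a \<in> Obj C. Ident D (fob F a))\<rparr>),
      Comp = (\<lambda>\<beta> \<alpha>. \<lparr>src = src \<alpha>, trg = trg \<beta>, cmp = (\<lambda>a \<in> Obj C. cmp \<beta> a \<cdot>\<^bsub>D\<^esub> cmp \<alpha> a)\<rparr>)\<rparr>"

abbreviation End_cat :: "('o, 'm) cat \<Rightarrow>
    (('o, 'm, 'o, 'm) functor_data, ('o, 'm, 'o, 'm) trans_data) cat" where
  "End_cat A \<equiv> functor_cat A A"

text \<open>Whiskering: \<open>whisker_left C H \<alpha>\<close> has components \<open>H(\<alpha>\<^sub>M)\<close>, and \<open>whisker_right C \<alpha> F\<close> has
  components \<open>\<alpha>\<close> at \<open>F M\<close>.\<close>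

definition whisker_left :: "('o, 'm) cat \<Rightarrow> ('p, 'n, 'q, 'k) functor_data \<Rightarrow>
    ('o, 'm, 'p, 'n) trans_data \<Rightarrow> ('o, 'm, 'q, 'k) trans_data" where
  "whisker_left C H \<alpha> =
     \<lparr>src = comp_functor C H (src \<alpha>), trg = comp_functor C H (trg \<alpha>),
      cmp = (\<lambda>M \<in> Obj C. far H (cmp \<alpha> M))\<rparr>"

definition whisker_right :: "('o, 'm) cat \<Rightarrow> ('p, 'n, 'q, 'k) trans_data \<Rightarrow>
    ('o, 'm, 'p, 'n) functor_data \<Rightarrow> ('o, 'm, 'q, 'k) trans_data" where
  "whisker_right C \<alpha> F =
     \<lparr>src = comp_functor C (src \<alpha>) F, trg = comp_functor C (trg \<alpha>) F,
      cmp = (\<lambda>M \<in> Obj C. cmp \<alpha> (fob F M))\<rparr>"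

section \<open>Simplicial and paracyclic objects\<close>

text \<open>\<open>d n i\<close> is the face \<open>\<partial>\<^sub>i : X\<^sub>n \<rightarrow> X\<^sub>n\<^sub>-\<^sub>1\<close> (relevant for \<open>n \<ge> 1\<close>) and \<open>s n i\<close> the degeneracy
  \<open>\<sigma>\<^sub>i : X\<^sub>n \<rightarrow> X\<^sub>n\<^sub>+\<^sub>1\<close>; values with \<open>i > n\<close> are irrelevant.\<close>

locale simplicial_object = category C
  for C :: "('o, 'm) cat" (structure) +
  fixes X :: "nat \<Rightarrow> 'o" and d s :: "nat \<Rightarrow> nat \<Rightarrow> 'm"
  assumes X_obj: "X n \<in> Obj C"
    and face_hom: "i \<le> Suc n \<Longrightarrow> d (Suc n) i \<in> Hom C (X (Suc n)) (X n)"
    and degen_hom: "i \<le> n \<Longrightarrow> s n i \<in> Hom C (X n) (X (Suc n))"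
    and face_face: "\<lbrakk>i < j; j \<le> Suc (Suc n)\<rbrakk> \<Longrightarrow>
      d (Suc n) i \<cdot> d (Suc (Suc n)) j = d (Suc n) (j - 1) \<cdot> d (Suc (Suc n)) i"
    and degen_degen: "\<lbrakk>i \<le> j; j \<le> n\<rbrakk> \<Longrightarrow>
      s (Suc n) i \<cdot> s n j = s (Suc n) (Suc j) \<cdot> s n i"
    and face_degen_less: "\<lbrakk>i < j; j \<le> n\<rbrakk> \<Longrightarrow>
      d (Suc n) i \<cdot> s n j = s (n - 1) (j - 1) \<cdot> d n i"
    and face_degen_same: "i \<le> n \<Longrightarrow> d (Suc n) i \<cdot> s n i = Ident C (X n)"
    and face_degen_Suc: "i \<le> n \<Longrightarrow> d (Suc n) (Suc i) \<cdot> s n i = Ident C (X n)"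
    and face_degen_greater: "\<lbrakk>Suc j < i; i \<le> Suc n\<rbrakk> \<Longrightarrow>
      d (Suc n) i \<cdot> s n j = s (n - 1) j \<cdot> d n (i - 1)"

locale augmented_simplicial_object = simplicial_object C X d s
  for C :: "('o, 'm) cat" (structure) and X d s +
  fixes Y :: 'o and e :: 'm
  assumes Y_obj: "Y \<in> Obj C"
    and aug_hom: "e \<in> Hom C (X 0) Y"
    and aug: "e \<cdot> d 1 0 = e \<cdot> d 1 1"

text \<open>Only \<open>t n\<close> with \<open>n \<ge> 1\<close> is a paracyclic operator; \<open>t_zero\<close> fixes the convention for \<open>n = 0\<close>.\<close>

locale paracyclic_object = simplicial_object C X d s
  for C :: "('o, 'm) cat" (structure) and X d s +
  fixes t :: "nat \<Rightarrow> 'm"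
  assumes t_zero: "t 0 = Ident C (X 0)"
    and t_hom: "n \<ge> 1 \<Longrightarrow> t n \<in> Hom C (X n) (X n)"
    and t_iso: "n \<ge> 1 \<Longrightarrow> is_iso C (t n)"
    and face_t: "\<lbrakk>n \<ge> 1; 0 < i; i \<le> n\<rbrakk> \<Longrightarrow> d n i \<cdot> t n = t (n - 1) \<cdot> d n (i - 1)"
    and degen_t: "\<lbrakk>n \<ge> 1; 0 < i; i \<le> n\<rbrakk> \<Longrightarrow> s n i \<cdot> t n = t (n + 1) \<cdot> s n (i - 1)"
    and face0_t: "n \<ge> 1 \<Longrightarrow> d n 0 \<cdot> t n = d n n"
    and degen0_t: "n \<ge> 1 \<Longrightarrow> s n 0 \<cdot> t n = t (n + 1) \<cdot> t (n + 1) \<cdot> s n n"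

locale augmented_paracyclic_object =
  augmented_simplicial_object C X d s Y e + paracyclic_object C X d s t
  for C :: "('o, 'm) cat" (structure) and X d s Y e t

section \<open>Comonads\<close>

locale comonad = category A
  for A :: "('o, 'm) cat" (structure) +
  fixes G :: "('o, 'm, 'o, 'm) functor_data"
    and \<delta> \<epsilon> :: "('o, 'm, 'o, 'm) trans_data"
  assumes G_functor: "is_functor A A G"
    and \<delta>_hom: "\<delta> \<in> Hom (End_cat A) G (comp_functor A G G)"
    and \<epsilon>_hom: "\<epsilon> \<in> Hom (End_cat A) G (id_functor A)"
    and coassoc: "M \<in> Obj A \<Longrightarrow>
      cmp \<delta> (fob G M) \<cdot> cmp \<delta> M = far G (cmp \<delta> M) \<cdot> cmp \<delta> M"
    and counit_left: "M \<in> Obj A \<Longrightarrow> cmp \<epsilon> (fob G M) \<cdot> cmp \<delta> M = Ident A (fob G M)"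
    and counit_right: "M \<in> Obj A \<Longrightarrow> far G (cmp \<epsilon> M) \<cdot> cmp \<delta> M = Ident A (fob G M)"

definition comonad_obj ::
  "('o, 'm) cat \<Rightarrow> ('o, 'm, 'o, 'm) functor_data \<Rightarrow> nat \<Rightarrow> ('o, 'm, 'o, 'm) functor_data" where
  "comonad_obj A G n = pow_functor A G (n + 1)"

definition comonad_face :: "('o, 'm) cat \<Rightarrow> ('o, 'm, 'o, 'm) functor_data \<Rightarrow>
    ('o, 'm, 'o, 'm) trans_data \<Rightarrow> nat \<Rightarrow> nat \<Rightarrow> ('o, 'm, 'o, 'm) trans_data" where
  "comonad_face A G \<epsilon> n i =
     whisker_left A (pow_functor A G i) (whisker_right A \<epsilon> (pow_functor A G (n - i)))"

definition comonad_degen :: "('o, 'm) cat \<Rightarrow> ('o, 'm, 'o, 'm) functor_data \<Rightarrow>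
    ('o, 'm, 'o, 'm) trans_data \<Rightarrow> nat \<Rightarrow> nat \<Rightarrow> ('o, 'm, 'o, 'm) trans_data" where
  "comonad_degen A G \<delta> n i =
     whisker_left A (pow_functor A G i) (whisker_right A \<delta> (pow_functor A G (n - i)))"

text \<open>
  The component at \<open>M\<close> is the composite, in this order, of the arrows \<open>G\<^sup>k(t\<^sub>N)\<close> with
  \<open>N = G\<^sup>n\<^sup>-\<^sup>1\<^sup>-\<^sup>k M\<close>, for \<open>k = 0, \<dots>, n - 1\<close>. For \<open>n = 0\<close> it is an identity.
\<close>

definition paracyclic_op :: "('o, 'm) cat \<Rightarrow> ('o, 'm, 'o, 'm) functor_data \<Rightarrow>
    ('o, 'm, 'o, 'm) trans_data \<Rightarrow> nat \<Rightarrow> ('o, 'm, 'o, 'm) trans_data" where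
  "paracyclic_op A G t n =
     \<lparr>src = pow_functor A G (n + 1), trg = pow_functor A G (n + 1),
      cmp = (\<lambda>M \<in> Obj A.
        foldr (Comp A)
          (map (\<lambda>k. far (pow_functor A G k) (cmp t (fob (pow_functor A G (n - 1 - k)) M))) [0..<n])
          (Ident A (fob (pow_functor A G (n + 1)) M)))\<rparr>"

end

theory Submission
  imports Defs
begin

text \<open>
  Composition on the left with \<open>G\<close> is itself a comonad on the category of endofunctors, with counit,
  comultiplication and twist given by whiskering \<open>\<epsilon>\<close>, \<open>\<delta>\<close> and \<open>t\<close> on the right. Its powers, applied to the
  identity functor, are the powers of \<open>G\<close>. It is therefore enough to show, for a comonad with a twist
  on any category and any object \<open>M\<close>, that the objects \<open>G\<^sup>n\<^sup>+\<^sup>1 M\<close> form an augmented paracyclic object;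
  applying this in the endofunctor category also gives naturality and invertibility of the operators.

  Write \<open>\<tau>\<^sub>k\<close> for the twist of the copies \<open>k\<close> and \<open>k + 1\<close> of \<open>G\<close>, counted from the outside, so that
  \<open>t\<^sub>n = \<tau>\<^sub>0 \<dots> \<tau>\<^sub>n\<^sub>-\<^sub>1\<close>. By naturality, operators on disjoint copies commute up to a shift of the index.
  The relations for \<open>\<partial>\<^sub>i t\<^sub>n\<close> and, with \<open>i > 0\<close>, for \<open>\<sigma>\<^sub>i t\<^sub>n\<close> then follow from the corresponding relations
  for a single twist. All these identities are stable under raising the indices by one, which is
  applying \<open>G\<close>, and so they are proved by induction on the index, with \<open>t\<^sub>n\<^sub>+\<^sub>1 = \<tau>\<^sub>0 G(t\<^sub>n)\<close>.

  The relation \<open>\<sigma>\<^sub>0 t\<^sub>n = t\<^sub>n\<^sub>+\<^sub>1\<^sup>2 \<sigma>\<^sub>n\<close> is the one with content. Moving \<open>\<sigma>\<^sub>0\<close> through \<open>t\<^sub>n\<close> produces the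
  product of the \<open>(\<tau>\<^sub>k \<tau>\<^sub>k\<^sub>+\<^sub>1)\<^sup>2\<close> in front of \<open>\<sigma>\<^sub>n\<close>. The Yang-Baxter equation gives
  \<open>t\<^sub>n\<^sub>+\<^sub>1\<^sup>2 = G(t\<^sub>n) t\<^sub>n\<^sub>+\<^sub>1 \<tau>\<^sub>n\<close> (\<open>T_T\<close>). Because the twist is invertible, \<open>t\<^sup>3 \<delta> = t \<delta>\<close> means
  \<open>t\<^sup>2 \<delta> = \<delta>\<close>, hence \<open>\<tau>\<^sub>n\<^sup>2 \<sigma>\<^sub>n = \<sigma>\<^sub>n\<close>. Together they yield
  \<open>\<tau>\<^sub>0 t\<^sub>n\<^sub>+\<^sub>1\<^sup>2 \<sigma>\<^sub>n = G(t\<^sub>n) t\<^sub>n\<^sub>+\<^sub>1 \<sigma>\<^sub>n\<close> (\<open>t_T_T_degen\<close>), which is exactly the cancellation that the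
  inductive step of \<open>degen_0_T\<close> requires.
\<close>

section \<open>Arrows in a category\<close>

context category begin

lemma HomI: "f \<in> Arr C \<Longrightarrow> Dom C f = a \<Longrightarrow> Cod C f = b \<Longrightarrow> f \<in> Hom C a b"
  by (simp add: Hom_def)

lemma ident_arr [simp]:
  "a \<in> Obj C \<Longrightarrow> Ident C a \<in> Arr C"
  "a \<in> Obj C \<Longrightarrow> Dom C (Ident C a) = a"
  "a \<in> Obj C \<Longrightarrow> Cod C (Ident C a) = a"
  using ident_hom[of a] by (auto simp: Hom_def)

lemma comp_arr [simp]:
  assumes "f \<in> Arr C" "g \<in> Arr C" "Cod C f = Dom C g"
  shows "g \<cdot> f \<in> Arr C" "Dom C (g \<cdot> f) = Dom C f" "Cod C (g \<cdot> f) = Cod C g"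
  using comp_hom[of f "Dom C f" "Cod C f" g "Cod C g"] assms by (auto simp: Hom_def)

lemma comp_ident [simp]:
  "f \<in> Arr C \<Longrightarrow> Cod C f = b \<Longrightarrow> Ident C b \<cdot> f = f"
  "f \<in> Arr C \<Longrightarrow> Dom C f = a \<Longrightarrow> f \<cdot> Ident C a = f"
  using ident_left ident_right by (auto simp: Hom_def)

lemma assoc [simp]:
  assumes "f \<in> Arr C" "g \<in> Arr C" "h \<in> Arr C" "Cod C f = Dom C g" "Cod C g = Dom C h"
  shows "(h \<cdot> g) \<cdot> f = h \<cdot> g \<cdot> f"
  using assms comp_assoc by (auto simp: Hom_def)

lemma is_isoI:
  assumes "f \<in> Arr C" "g \<in> Arr C" "Dom C g = Cod C f" "Cod C g = Dom C f"
    "g \<cdot> f = Ident C (Dom C f)" "f \<cdot> g = Ident C (Cod C f)"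
  shows "is_iso C f"
  using assms unfolding is_iso_def Hom_def by blast

lemma is_isoE:
  assumes "is_iso C f"
  obtains g where "f \<in> Arr C" "g \<in> Arr C" "Dom C g = Cod C f" "Cod C g = Dom C f"
    "g \<cdot> f = Ident C (Dom C f)" "f \<cdot> g = Ident C (Cod C f)"
  using assms unfolding is_iso_def Hom_def by blast

lemma iso_ident: "a \<in> Obj C \<Longrightarrow> is_iso C (Ident C a)"
  by (rule is_isoI[where g = "Ident C a"]) simp_all

lemma iso_comp:
  assumes "is_iso C f" "is_iso C g" "Cod C f = Dom C g"
  shows "is_iso C (g \<cdot> f)"
proof -
  obtain f' where f': "f \<in> Arr C" "f' \<in> Arr C" "Dom C f' = Cod C f" "Cod C f' = Dom C f"
    "f' \<cdot> f = Ident C (Dom C f)" "f \<cdot> f' = Ident C (Cod C f)"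
    using assms(1) by (rule is_isoE)
  obtain g' where g': "g \<in> Arr C" "g' \<in> Arr C" "Dom C g' = Cod C g" "Cod C g' = Dom C g"
    "g' \<cdot> g = Ident C (Dom C g)" "g \<cdot> g' = Ident C (Cod C g)"
    using assms(2) by (rule is_isoE)
  note [simp] = f'(1-4) g'(1-4) assms(3)
  have [simp]: "Dom C g \<in> Obj C" "Dom C f \<in> Obj C"
    using dom_obj f'(1) g'(1) by auto
  have "(f' \<cdot> g') \<cdot> g \<cdot> f = f' \<cdot> (g' \<cdot> g) \<cdot> f" by simp
  also have "\<dots> = Ident C (Dom C f)" by (simp add: f'(5) g'(5) del: assoc)
  finally have l: "(f' \<cdot> g') \<cdot> g \<cdot> f = Ident C (Dom C f)" .
  have "(g \<cdot> f) \<cdot> f' \<cdot> g' = g \<cdot> (f \<cdot> f') \<cdot> g'" by simp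
  also have "\<dots> = Ident C (Cod C g)" by (simp add: f'(6) g'(6) del: assoc)
  finally have r: "(g \<cdot> f) \<cdot> f' \<cdot> g' = Ident C (Cod C g)" .
  from l r show ?thesis by (intro is_isoI[where g = "f' \<cdot> g'"]) simp_all
qed

end

section \<open>The simplicial object of a comonad\<close>

text \<open>
  A comonad acting on a category, with a chosen object \<open>M\<close>. The endofunctor is given by bare maps
  \<open>g\<close> on objects and \<open>G\<close> on arrows, constrained only on the category, so that the locale can be
  interpreted in a functor category without making these maps extensional.
\<close>

locale comonad_at_object = category C
  for C :: "('o, 'm) cat" (structure) +
  fixes g :: "'o \<Rightarrow> 'o" and G :: "'m \<Rightarrow> 'm" and \<epsilon> \<delta> :: "'o \<Rightarrow> 'm" and M :: 'o
  assumes g_obj [simp]: "a \<in> Obj C \<Longrightarrow> g a \<in> Obj C"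
    and G_arr [simp]: "f \<in> Arr C \<Longrightarrow> G f \<in> Arr C"
    and G_dom [simp]: "f \<in> Arr C \<Longrightarrow> Dom C (G f) = g (Dom C f)"
    and G_cod [simp]: "f \<in> Arr C \<Longrightarrow> Cod C (G f) = g (Cod C f)"
    and G_ident [simp]: "a \<in> Obj C \<Longrightarrow> G (Ident C a) = Ident C (g a)"
    and G_comp: "\<lbrakk>f \<in> Arr C; h \<in> Arr C; Cod C f = Dom C h\<rbrakk> \<Longrightarrow> G (h \<cdot> f) = G h \<cdot> G f"
    and e_arr [simp]: "a \<in> Obj C \<Longrightarrow> \<epsilon> a \<in> Arr C"
    and e_dom [simp]: "a \<in> Obj C \<Longrightarrow> Dom C (\<epsilon> a) = g a"
    and e_cod [simp]: "a \<in> Obj C \<Longrightarrow> Cod C (\<epsilon> a) = a"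
    and dl_arr [simp]: "a \<in> Obj C \<Longrightarrow> \<delta> a \<in> Arr C"
    and dl_dom [simp]: "a \<in> Obj C \<Longrightarrow> Dom C (\<delta> a) = g a"
    and dl_cod [simp]: "a \<in> Obj C \<Longrightarrow> Cod C (\<delta> a) = g (g a)"
    and e_nat: "f \<in> Hom C a b \<Longrightarrow> \<epsilon> b \<cdot> G f = f \<cdot> \<epsilon> a"
    and dl_nat: "f \<in> Hom C a b \<Longrightarrow> \<delta> b \<cdot> G f = G (G f) \<cdot> \<delta> a"
    and dl_dl: "a \<in> Obj C \<Longrightarrow> \<delta> (g a) \<cdot> \<delta> a = G (\<delta> a) \<cdot> \<delta> a"
    and e_dl: "a \<in> Obj C \<Longrightarrow> \<epsilon> (g a) \<cdot> \<delta> a = Ident C (g a)"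
    and Ge_dl: "a \<in> Obj C \<Longrightarrow> G (\<epsilon> a) \<cdot> \<delta> a = Ident C (g a)"
    and M_obj [simp]: "M \<in> Obj C"
begin

abbreviation P :: "nat \<Rightarrow> 'o" where
  "P n \<equiv> (g ^^ n) M"

definition face :: "nat \<Rightarrow> nat \<Rightarrow> 'm" where
  "face n i = (G ^^ i) (\<epsilon> (P (n - i)))"

definition degen :: "nat \<Rightarrow> nat \<Rightarrow> 'm" where
  "degen n i = (G ^^ i) (\<delta> (P (n - i)))"

lemma P_obj [simp]: "P n \<in> Obj C"
  by (induction n) simp_all

text \<open>The step of the shift inductions below: the functor carries commutative squares to such squares.\<close>

lemma G_square:
  assumes "h \<cdot> f = h' \<cdot> f'" "f \<in> Arr C" "h \<in> Arr C" "f' \<in> Arr C" "h' \<in> Arr C"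
    "Cod C f = Dom C h" "Cod C f' = Dom C h'"
  shows "G h \<cdot> G f = G h' \<cdot> G f'"
  using assms G_comp[of f h] G_comp[of f' h'] by simp

lemma face_0: "face n 0 = \<epsilon> (P n)"
  by (simp add: face_def)

text \<open>
  Raising both indices of a face or a degeneracy by one is applying the functor. A simplicial identity
  therefore needs a proof only when one of its operators has index 0 on the outermost copy of the
  functor, and there it is naturality of \<open>\<epsilon>\<close> or \<open>\<delta>\<close> or a comonad law.
\<close>

lemma face_Suc: "face (Suc n) (Suc i) = G (face n i)"
  by (simp add: face_def)

lemma degen_0: "degen n 0 = \<delta> (P n)"
  by (simp add: degen_def)

lemma degen_Suc: "degen (Suc n) (Suc i) = G (degen n i)"
  by (simp add: degen_def)

lemma face_arr [simp]:
  assumes "i \<le> n"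
  shows "face n i \<in> Arr C" "Dom C (face n i) = P (Suc n)" "Cod C (face n i) = P n"
proof -
  have "face n i \<in> Arr C \<and> Dom C (face n i) = P (Suc n) \<and> Cod C (face n i) = P n"
    using assms
  proof (induction i arbitrary: n)
    case (Suc i)
    then show ?case by (cases n) (simp_all add: face_Suc)
  qed (simp add: face_0)
  then show "face n i \<in> Arr C" "Dom C (face n i) = P (Suc n)" "Cod C (face n i) = P n"
    by auto
qed

lemma degen_arr [simp]:
  assumes "i \<le> n"
  shows "degen n i \<in> Arr C" "Dom C (degen n i) = P (Suc n)" "Cod C (degen n i) = P (Suc (Suc n))"
proof -
  have "degen n i \<in> Arr C \<and> Dom C (degen n i) = P (Suc n) \<and> Cod C (degen n i) = P (Suc (Suc n))"
    using assms
  proof (induction i arbitrary: n)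
    case (Suc i)
    then show ?case by (cases n) (simp_all add: degen_Suc)
  qed (simp add: degen_0)
  then show "degen n i \<in> Arr C" "Dom C (degen n i) = P (Suc n)" "Cod C (degen n i) = P (Suc (Suc n))"
    by auto
qed

lemma face_in_hom: "i \<le> n \<Longrightarrow> face n i \<in> Hom C (P (Suc n)) (P n)"
  by (rule HomI) simp_all

lemma degen_in_hom: "i \<le> n \<Longrightarrow> degen n i \<in> Hom C (P (Suc n)) (P (Suc (Suc n)))"
  by (rule HomI) simp_all

text \<open>
  The case \<open>n = 0\<close> is the augmentation identity \<open>\<epsilon> \<partial>\<^sub>0 = \<epsilon> \<partial>\<^sub>1\<close>, since \<open>face 0 0\<close> is \<open>\<epsilon>\<close> at \<open>M\<close>.
\<close>

lemma face_face:
  "i \<le> j \<Longrightarrow> j \<le> n \<Longrightarrow> face n i \<cdot> face (Suc n) (Suc j) = face n j \<cdot> face (Suc n) i"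
proof (induction i arbitrary: j n)
  case 0
  then show ?case using e_nat[OF face_in_hom[of j n]] by (simp add: face_0 face_Suc)
next
  case (Suc i)
  then obtain j' n' where [simp]: "j = Suc j'" "n = Suc n'"
    by (metis Suc_le_D)
  show ?case
    using Suc.prems G_square[OF Suc.IH[of j' n']] by (simp add: face_Suc degen_Suc)
qed

lemma degen_degen:
  "i \<le> j \<Longrightarrow> j \<le> n \<Longrightarrow> degen (Suc n) i \<cdot> degen n j = degen (Suc n) (Suc j) \<cdot> degen n i"
proof (induction i arbitrary: j n)
  case 0
  show ?case
  proof (cases j)
    case 0
    then show ?thesis using dl_dl[of "P n"] by (simp add: degen_0 degen_Suc)
  next
    case (Suc j')
    then obtain n' where [simp]: "n = Suc n'" using 0 by (metis Suc_le_D)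
    show ?thesis using Suc 0 dl_nat[OF degen_in_hom[of j' n']] by (simp add: degen_0 degen_Suc)
  qed
next
  case (Suc i)
  then obtain j' n' where [simp]: "j = Suc j'" "n = Suc n'"
    by (metis Suc_le_D)
  show ?case
    using Suc.prems G_square[OF Suc.IH[of j' n']] by (simp add: face_Suc degen_Suc)
qed

lemma face_degen_less:
  "i \<le> j \<Longrightarrow> j \<le> n \<Longrightarrow> face (Suc (Suc n)) i \<cdot> degen (Suc n) (Suc j) = degen n j \<cdot> face (Suc n) i"
proof (induction i arbitrary: j n)
  case 0
  then show ?case using e_nat[OF degen_in_hom[of j n]] by (simp add: face_0 degen_Suc)
next
  case (Suc i)
  then obtain j' n' where [simp]: "j = Suc j'" "n = Suc n'"
    by (metis Suc_le_D)
  show ?case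
    using Suc.prems G_square[OF Suc.IH[of j' n']] by (simp add: face_Suc degen_Suc)
qed

lemma face_degen_same: "i \<le> n \<Longrightarrow> face (Suc n) i \<cdot> degen n i = Ident C (P (Suc n))"
proof (induction i arbitrary: n)
  case 0
  then show ?case using e_dl[of "P n"] by (simp add: face_0 degen_0)
next
  case (Suc i)
  then obtain n' where [simp]: "n = Suc n'" by (metis Suc_le_D)
  show ?case
    using Suc G_comp[of "degen n' i" "face (Suc n') i"] by (simp add: face_Suc degen_Suc)
qed

lemma face_degen_Suc: "i \<le> n \<Longrightarrow> face (Suc n) (Suc i) \<cdot> degen n i = Ident C (P (Suc n))"
proof (induction i arbitrary: n)
  case 0
  then show ?case using Ge_dl[of "P n"] by (simp add: face_0 face_Suc degen_0)
next
  case (Suc i)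
  then obtain n' where [simp]: "n = Suc n'" by (metis Suc_le_D)
  show ?case
    using Suc G_comp[of "degen n' i" "face (Suc n') (Suc i)"] by (simp add: face_Suc degen_Suc)
qed

lemma face_degen_greater:
  "j \<le> i \<Longrightarrow> i \<le> n \<Longrightarrow> face (Suc (Suc n)) (Suc (Suc i)) \<cdot> degen (Suc n) j = degen n j \<cdot> face (Suc n) (Suc i)"
proof (induction j arbitrary: i n)
  case 0
  then show ?case using dl_nat[OF face_in_hom[of i n]] by (simp add: face_Suc degen_0)
next
  case (Suc j)
  then obtain i' n' where [simp]: "i = Suc i'" "n = Suc n'"
    by (metis Suc_le_D)
  show ?case
    using Suc.prems G_square[OF Suc.IH[of i' n']] by (simp add: face_Suc degen_Suc)
qed

lemma augmented_simplicial:
  "augmented_simplicial_object C (\<lambda>n. P (Suc n)) face degen M (\<epsilon> M)"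
proof (unfold_locales, goal_cases)
  case (4 i j n)
  then show ?case using face_face[of i "j - 1" "Suc n"] by (cases j) simp_all
next
  case (6 i j n)
  then show ?case
    using face_degen_less[of i "j - 1" "n - 1"] by (cases j; cases n) simp_all
next
  case (9 j i n)
  then show ?case
    using face_degen_greater[of j "i - 2" "n - 1"]
    by (cases n; cases i; cases "i - 1") simp_all
next
  case 11
  then show ?case by (simp add: Hom_def)
next
  case 12
  then show ?case using face_face[of 0 0 0] by (simp add: face_0)
qed (use face_degen_same face_degen_Suc degen_degen in \<open>auto simp: Hom_def simp del: funpow.simps\<close>)

end


section \<open>Paracyclic operators from a twist of the comonad\<close>

locale paracyclic_comonad_at_object = comonad_at_object C g G \<epsilon> \<delta> M
  for C :: "('o, 'm) cat" (structure) and g G \<epsilon> \<delta> M +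
  fixes t :: "'o \<Rightarrow> 'm"
  assumes t_arr [simp]: "a \<in> Obj C \<Longrightarrow> t a \<in> Arr C"
    and t_dom [simp]: "a \<in> Obj C \<Longrightarrow> Dom C (t a) = g (g a)"
    and t_cod [simp]: "a \<in> Obj C \<Longrightarrow> Cod C (t a) = g (g a)"
    and t_nat: "f \<in> Hom C a b \<Longrightarrow> t b \<cdot> G (G f) = G (G f) \<cdot> t a"
    and t_inv: "a \<in> Obj C \<Longrightarrow> is_iso C (t a)"
    and Ge_t: "a \<in> Obj C \<Longrightarrow> G (\<epsilon> a) \<cdot> t a = \<epsilon> (g a)"
    and e_t: "a \<in> Obj C \<Longrightarrow> \<epsilon> (g a) \<cdot> t a = G (\<epsilon> a)"
    and Gdl_t: "a \<in> Obj C \<Longrightarrow> G (\<delta> a) \<cdot> t a = t (g a) \<cdot> G (t a) \<cdot> \<delta> (g a)"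
    and dl_t: "a \<in> Obj C \<Longrightarrow>
      \<delta> (g a) \<cdot> t a = t (g a) \<cdot> G (t a) \<cdot> t (g a) \<cdot> G (t a) \<cdot> G (\<delta> a)"
    and yang_baxter: "a \<in> Obj C \<Longrightarrow> G (t a) \<cdot> t (g a) \<cdot> G (t a) = t (g a) \<cdot> G (t a) \<cdot> t (g a)"
    and t_t_t_dl: "a \<in> Obj C \<Longrightarrow> t a \<cdot> t a \<cdot> t a \<cdot> \<delta> a = t a \<cdot> \<delta> a"
begin

text \<open>
  The operator \<open>T n\<close> carries one copy of the functor past the \<open>n\<close> others. Splitting off the outermost
  twist makes the remaining factors the image of \<open>T (n - 1)\<close>, which suits the shift inductions.
\<close>

primrec T :: "nat \<Rightarrow> 'm" where
  "T 0 = Ident C (P 1)"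
| "T (Suc n) = t (P n) \<cdot> G (T n)"

text \<open>The twist of the two innermost copies of the functor.\<close>

definition R :: "nat \<Rightarrow> 'm" where
  "R n = (G ^^ n) (t M)"

lemma R_rec: "R 0 = t M" "R (Suc n) = G (R n)"
  by (simp_all add: R_def)

lemma T_typing: "T n \<in> Arr C \<and> Dom C (T n) = P (Suc n) \<and> Cod C (T n) = P (Suc n)"
  by (induction n) simp_all

lemma T_arr [simp]: "T n \<in> Arr C" "Dom C (T n) = P (Suc n)" "Cod C (T n) = P (Suc n)"
  using T_typing by auto

lemma R_typing: "R n \<in> Arr C \<and> Dom C (R n) = P (Suc (Suc n)) \<and> Cod C (R n) = P (Suc (Suc n))"
  by (induction n) (simp_all add: R_rec)

lemma R_arr [simp]: "R n \<in> Arr C" "Dom C (R n) = P (Suc (Suc n))" "Cod C (R n) = P (Suc (Suc n))"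
  using R_typing by auto

lemma G_iso: "is_iso C f \<Longrightarrow> is_iso C (G f)"
proof (erule is_isoE, rule is_isoI)
  fix h
  assume "f \<in> Arr C" "h \<in> Arr C" "Dom C h = Cod C f" "Cod C h = Dom C f"
    "h \<cdot> f = Ident C (Dom C f)" "f \<cdot> h = Ident C (Cod C f)"
  then show "G f \<in> Arr C" "G h \<in> Arr C" "Dom C (G h) = Cod C (G f)" "Cod C (G h) = Dom C (G f)"
    "G h \<cdot> G f = Ident C (Dom C (G f))" "G f \<cdot> G h = Ident C (Cod C (G f))"
    using G_comp[of f h] G_comp[of h f] dom_obj[of f] cod_obj[of f] by simp_all
qed

lemma T_iso: "is_iso C (T n)"
  by (induction n) (auto intro!: iso_ident iso_comp G_iso t_inv)

text \<open>One factor of the hypothesis on the cube of the twist cancels, because the twist is invertible.\<close>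

lemma t_t_dl:
  assumes [simp]: "a \<in> Obj C"
  shows "t a \<cdot> t a \<cdot> \<delta> a = \<delta> a"
proof -
  obtain u where u: "u \<in> Arr C" "Dom C u = g (g a)" "Cod C u = g (g a)" "u \<cdot> t a = Ident C (g (g a))"
    using is_isoE[OF t_inv[OF assms]] t_dom[OF assms] t_cod[OF assms] by metis
  note [simp] = u(1-3)
  have "t a \<cdot> t a \<cdot> \<delta> a = (u \<cdot> t a) \<cdot> t a \<cdot> t a \<cdot> \<delta> a" by (simp add: u(4) del: assoc)
  also have "\<dots> = u \<cdot> t a \<cdot> t a \<cdot> t a \<cdot> \<delta> a" by simp
  also have "\<dots> = u \<cdot> t a \<cdot> \<delta> a" by (simp only: t_t_t_dl assms)
  also have "\<dots> = (u \<cdot> t a) \<cdot> \<delta> a" by simp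
  also have "\<dots> = \<delta> a" by (simp add: u(4) del: assoc)
  finally show ?thesis .
qed

lemma R_R_degen: "R n \<cdot> R n \<cdot> degen n n = degen n n"
proof (induction n)
  case 0
  show ?case using t_t_dl[of M] by (simp add: R_rec degen_0)
next
  case (Suc n)
  have "R (Suc n) \<cdot> R (Suc n) \<cdot> degen (Suc n) (Suc n) = G (R n \<cdot> R n \<cdot> degen n n)"
    by (simp add: R_rec degen_Suc G_comp)
  with Suc show ?case by (simp add: degen_Suc)
qed

text \<open>The counit on the outer of two copies absorbs their twist and becomes the counit on the inner one,
  where it meets the next twist.\<close>

lemma face_0_T: "face n 0 \<cdot> T n = face n n"
proof (induction n)
  case 0
  show ?case by (simp add: face_0)
next
  case (Suc n)
  have "face (Suc n) 0 \<cdot> T (Suc n) = (\<epsilon> (g (P n)) \<cdot> t (P n)) \<cdot> G (T n)"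
    by (simp add: face_0)
  also have "\<dots> = G (\<epsilon> (P n)) \<cdot> G (T n)" by (simp only: e_t P_obj)
  also have "\<dots> = G (face n 0 \<cdot> T n)" by (simp add: face_0 G_comp)
  finally show ?case using Suc by (simp add: face_Suc)
qed

lemma face_Suc_T: "i \<le> n \<Longrightarrow> face (Suc n) (Suc i) \<cdot> T (Suc n) = T n \<cdot> face (Suc n) i"
proof (induction i arbitrary: n)
  case 0
  have "face (Suc n) (Suc 0) \<cdot> T (Suc n) = (G (\<epsilon> (P n)) \<cdot> t (P n)) \<cdot> G (T n)"
    by (simp add: face_0 face_Suc)
  also have "\<dots> = \<epsilon> (g (P n)) \<cdot> G (T n)" by (simp only: Ge_t P_obj)
  also have "\<dots> = T n \<cdot> face (Suc n) 0"
    using e_nat[of "T n" "P (Suc n)" "P (Suc n)"] by (simp add: face_0 Hom_def)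
  finally show ?case .
next
  case (Suc i)
  then obtain m where [simp]: "n = Suc m" by (metis Suc_le_D)
  have im [simp]: "i \<le> m" using Suc.prems by simp
  have "face (Suc n) (Suc (Suc i)) \<cdot> T (Suc n) = (G (G (face m i)) \<cdot> t (P (Suc m))) \<cdot> G (T (Suc m))"
    by (simp add: face_Suc)
  also have "\<dots> = (t (P m) \<cdot> G (G (face m i))) \<cdot> G (T (Suc m))"
    using t_nat[OF face_in_hom[OF im]] by (simp only:)
  also have "\<dots> = t (P m) \<cdot> G (face (Suc m) (Suc i) \<cdot> T (Suc m))"
    by (simp add: face_Suc G_comp)
  also have "\<dots> = t (P m) \<cdot> G (T m \<cdot> face (Suc m) i)"
    by (simp only: Suc.IH[OF im])
  also have "\<dots> = T n \<cdot> face (Suc n) (Suc i)"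
    by (simp add: G_comp face_Suc le_SucI)
  finally show ?case .
qed

lemma degen_Suc_T: "i \<le> n \<Longrightarrow> degen (Suc n) (Suc i) \<cdot> T (Suc n) = T (Suc (Suc n)) \<cdot> degen (Suc n) i"
proof (induction i arbitrary: n)
  case 0
  have "degen (Suc n) (Suc 0) \<cdot> T (Suc n) = (G (\<delta> (P n)) \<cdot> t (P n)) \<cdot> G (T n)"
    by (simp add: degen_0 degen_Suc)
  also have "\<dots> = (t (g (P n)) \<cdot> G (t (P n)) \<cdot> \<delta> (g (P n))) \<cdot> G (T n)"
    by (simp only: Gdl_t P_obj)
  also have "\<dots> = t (g (P n)) \<cdot> G (t (P n)) \<cdot> (\<delta> (P (Suc n)) \<cdot> G (T n))"
    by simp
  also have "\<dots> = t (g (P n)) \<cdot> G (t (P n)) \<cdot> (G (G (T n)) \<cdot> \<delta> (P (Suc n)))"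
    by (subst dl_nat[OF HomI, where a = "P (Suc n)"]) simp_all
  also have "\<dots> = T (Suc (Suc n)) \<cdot> degen (Suc n) 0"
    by (simp add: degen_0 G_comp)
  finally show ?case .
next
  case (Suc i)
  then obtain m where [simp]: "n = Suc m" by (metis Suc_le_D)
  have im [simp]: "i \<le> m" using Suc.prems by simp
  have "degen (Suc n) (Suc (Suc i)) \<cdot> T (Suc n) = (G (G (degen m i)) \<cdot> t (P (Suc m))) \<cdot> G (T (Suc m))"
    by (simp add: degen_Suc)
  also have "\<dots> = (t (P (Suc (Suc m))) \<cdot> G (G (degen m i))) \<cdot> G (T (Suc m))"
    using t_nat[OF degen_in_hom[OF im]] by (simp only:)
  also have "\<dots> = t (P (Suc (Suc m))) \<cdot> G (degen (Suc m) (Suc i) \<cdot> T (Suc m))"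
    by (simp add: degen_Suc G_comp)
  also have "\<dots> = t (P (Suc (Suc m))) \<cdot> G (T (Suc (Suc m)) \<cdot> degen (Suc m) i)"
    by (simp only: Suc.IH[OF im])
  also have "\<dots> = T (Suc (Suc n)) \<cdot> degen (Suc n) (Suc i)"
    by (simp add: G_comp degen_Suc le_SucI)
  finally show ?case .
qed

lemma t_GG_T: "t (P (Suc n)) \<cdot> G (G (T n)) = G (G (T n)) \<cdot> t (P (Suc n))"
  by (rule t_nat[OF HomI]) simp_all

text \<open>
  This is where the Yang-Baxter equation enters. In braid words, with \<open>\<tau>\<^sub>k\<close> the twist of the copies
  \<open>k\<close> and \<open>k + 1\<close>, conjugation by \<open>\<tau>\<^sub>0 \<dots> \<tau>\<^sub>n\<close> turns \<open>\<tau>\<^sub>k\<close> into \<open>\<tau>\<^sub>k\<^sub>+\<^sub>1\<close> for \<open>k < n\<close>, so that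
  \<open>(\<tau>\<^sub>0 \<dots> \<tau>\<^sub>n) (\<tau>\<^sub>0 \<dots> \<tau>\<^sub>n\<^sub>-\<^sub>1) = (\<tau>\<^sub>1 \<dots> \<tau>\<^sub>n) (\<tau>\<^sub>0 \<dots> \<tau>\<^sub>n)\<close>; the factor \<open>\<tau>\<^sub>n\<close> is left over.
\<close>

lemma T_T: "T (Suc n) \<cdot> T (Suc n) = G (T n) \<cdot> T (Suc n) \<cdot> R n"
proof (induction n)
  case 0
  show ?case by (simp add: R_rec)
next
  case (Suc n)
  let ?u = "t (P n)" and ?v = "t (P (Suc n))" and ?w = "G (G (T n))"
  have "T (Suc (Suc n)) \<cdot> T (Suc (Suc n)) = ?v \<cdot> G ?u \<cdot> (?w \<cdot> ?v) \<cdot> G ?u \<cdot> ?w"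
    by (simp add: G_comp)
  also have "\<dots> = ?v \<cdot> G ?u \<cdot> (?v \<cdot> ?w) \<cdot> G ?u \<cdot> ?w"
    by (simp only: t_GG_T)
  also have "\<dots> = (?v \<cdot> G ?u \<cdot> ?v) \<cdot> ?w \<cdot> G ?u \<cdot> ?w"
    by simp
  also have "\<dots> = (G ?u \<cdot> ?v \<cdot> G ?u) \<cdot> ?w \<cdot> G ?u \<cdot> ?w"
    using yang_baxter[of "P n"] by (simp del: assoc)
  also have "\<dots> = G ?u \<cdot> ?v \<cdot> G (T (Suc n) \<cdot> T (Suc n))"
    by (simp add: G_comp)
  also have "\<dots> = G ?u \<cdot> ?v \<cdot> G (G (T n) \<cdot> T (Suc n) \<cdot> R n)"
    by (simp only: Suc)
  also have "\<dots> = G ?u \<cdot> (?v \<cdot> ?w) \<cdot> G (T (Suc n)) \<cdot> G (R n)"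
    by (simp add: G_comp)
  also have "\<dots> = G ?u \<cdot> (?w \<cdot> ?v) \<cdot> G (T (Suc n)) \<cdot> G (R n)"
    by (simp only: t_GG_T)
  also have "\<dots> = G (T (Suc n)) \<cdot> T (Suc (Suc n)) \<cdot> R (Suc n)"
    by (simp add: G_comp R_rec)
  finally show ?case .
qed

text \<open>
  Two uses of the previous lemma produce the square of the innermost twist, which the last degeneracy
  absorbs. The factor \<open>t (P n)\<close> in front is the one that \<open>dl_t\<close> produces beyond the twists of
  \<open>T (n + 2)\<^sup>2\<close> in the inductive step for \<open>degen_0_T\<close>.
\<close>

lemma t_T_T_degen: "t (P n) \<cdot> T (Suc n) \<cdot> T (Suc n) \<cdot> degen n n = G (T n) \<cdot> T (Suc n) \<cdot> degen n n"
proof -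
  have "t (P n) \<cdot> T (Suc n) \<cdot> T (Suc n) \<cdot> degen n n = t (P n) \<cdot> (T (Suc n) \<cdot> T (Suc n)) \<cdot> degen n n"
    by simp
  also have "\<dots> = t (P n) \<cdot> (G (T n) \<cdot> T (Suc n) \<cdot> R n) \<cdot> degen n n"
    by (simp only: T_T)
  also have "\<dots> = (T (Suc n) \<cdot> T (Suc n)) \<cdot> R n \<cdot> degen n n"
    by simp
  also have "\<dots> = (G (T n) \<cdot> T (Suc n) \<cdot> R n) \<cdot> R n \<cdot> degen n n"
    by (simp only: T_T)
  also have "\<dots> = G (T n) \<cdot> T (Suc n) \<cdot> (R n \<cdot> R n \<cdot> degen n n)"
    by simp
  also have "\<dots> = G (T n) \<cdot> T (Suc n) \<cdot> degen n n"
    by (simp only: R_R_degen)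
  finally show ?thesis .
qed

text \<open>
  For \<open>n = 0\<close> this is \<open>t_t_dl\<close>, which allows the induction to start there. In the step, \<open>dl_t\<close>
  creates four twists; \<open>t_T_T_degen\<close> cancels the last of them against the square that the induction
  hypothesis provides, and what remains is \<open>T (n + 2)\<^sup>2\<close>.
\<close>

lemma degen_0_T: "degen n 0 \<cdot> T n = T (Suc n) \<cdot> T (Suc n) \<cdot> degen n n"
proof (induction n)
  case 0
  show ?case using t_t_dl[of M] by (simp add: degen_0)
next
  case (Suc n)
  let ?u = "t (P n)" and ?v = "t (P (Suc n))" and ?w = "G (G (T n))"
  have "degen (Suc n) 0 \<cdot> T (Suc n) = (\<delta> (g (P n)) \<cdot> ?u) \<cdot> G (T n)"
    by (simp add: degen_0)
  also have "\<dots> = (?v \<cdot> G ?u \<cdot> ?v \<cdot> G ?u \<cdot> G (\<delta> (P n))) \<cdot> G (T n)"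
    using dl_t[of "P n"] by (simp del: assoc)
  also have "\<dots> = ?v \<cdot> G ?u \<cdot> ?v \<cdot> G ?u \<cdot> G (degen n 0 \<cdot> T n)"
    by (simp add: degen_0 G_comp)
  also have "\<dots> = ?v \<cdot> G ?u \<cdot> ?v \<cdot> G (t (P n) \<cdot> T (Suc n) \<cdot> T (Suc n) \<cdot> degen n n)"
    unfolding Suc by (simp add: G_comp)
  also have "\<dots> = ?v \<cdot> G ?u \<cdot> ?v \<cdot> G (G (T n) \<cdot> T (Suc n) \<cdot> degen n n)"
    by (simp only: t_T_T_degen)
  also have "\<dots> = ?v \<cdot> G ?u \<cdot> (?v \<cdot> ?w) \<cdot> G (T (Suc n)) \<cdot> G (degen n n)"
    by (simp add: G_comp)
  also have "\<dots> = ?v \<cdot> G ?u \<cdot> (?w \<cdot> ?v) \<cdot> G (T (Suc n)) \<cdot> G (degen n n)"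
    by (simp only: t_GG_T)
  also have "\<dots> = T (Suc (Suc n)) \<cdot> T (Suc (Suc n)) \<cdot> degen (Suc n) (Suc n)"
    by (simp add: G_comp degen_Suc)
  finally show ?case .
qed

lemma augmented_paracyclic:
  "augmented_paracyclic_object C (\<lambda>n. P (Suc n)) face degen M (\<epsilon> M) T"
proof -
  interpret augmented_simplicial_object C "\<lambda>n. P (Suc n)" face degen M "\<epsilon> M"
    by (rule augmented_simplicial)
  show ?thesis
  proof (unfold_locales, goal_cases)
    case (4 n i)
    then show ?case using face_Suc_T[of "i - 1" "n - 1"] by (cases n; cases i) (simp_all del: T.simps)
  next
    case (5 n i)
    then show ?case using degen_Suc_T[of "i - 1" "n - 1"] by (cases n; cases i) (simp_all del: T.simps)
  qed (use T_iso face_0_T degen_0_T in \<open>simp_all add: Hom_def del: T.simps\<close>, simp)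
qed

end

section \<open>Functor categories and whiskering\<close>

lemma functor_objD: "is_functor C D F \<Longrightarrow> a \<in> Obj C \<Longrightarrow> fob F a \<in> Obj D"
  unfolding is_functor_def by blast

lemma functor_arrD:
  assumes "is_functor C D F" "f \<in> Arr C"
  shows "far F f \<in> Arr D" "Dom D (far F f) = fob F (Dom C f)" "Cod D (far F f) = fob F (Cod C f)"
  using assms unfolding is_functor_def Hom_def by blast+

lemma functor_ident: "is_functor C D F \<Longrightarrow> a \<in> Obj C \<Longrightarrow> far F (Ident C a) = Ident D (fob F a)"
  unfolding is_functor_def by blast

lemma functor_comp:
  "is_functor C D F \<Longrightarrow> f \<in> Arr C \<Longrightarrow> h \<in> Arr C \<Longrightarrow> Cod C f = Dom C h \<Longrightarrow>
    far F (h \<cdot>\<^bsub>C\<^esub> f) = far F h \<cdot>\<^bsub>D\<^esub> far F f"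
  unfolding is_functor_def by blast

lemma functor_undefined:
  assumes "is_functor C D F"
  shows "a \<notin> Obj C \<Longrightarrow> fob F a = undefined" "f \<notin> Arr C \<Longrightarrow> far F f = undefined"
  using assms unfolding is_functor_def extensional_def by blast+

lemma nat_trans_arrD:
  assumes "nat_trans C D \<alpha>" "a \<in> Obj C"
  shows "cmp \<alpha> a \<in> Arr D" "Dom D (cmp \<alpha> a) = fob (src \<alpha>) a" "Cod D (cmp \<alpha> a) = fob (trg \<alpha>) a"
  using assms unfolding nat_trans_def Hom_def by blast+

lemma nat_trans_functorD:
  assumes "nat_trans C D \<alpha>"
  shows "is_functor C D (src \<alpha>)" "is_functor C D (trg \<alpha>)"
  using assms unfolding nat_trans_def by blast+

lemma nat_trans_naturality:
  "nat_trans C D \<alpha> \<Longrightarrow> f \<in> Arr C \<Longrightarrow>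
    cmp \<alpha> (Cod C f) \<cdot>\<^bsub>D\<^esub> far (src \<alpha>) f = far (trg \<alpha>) f \<cdot>\<^bsub>D\<^esub> cmp \<alpha> (Dom C f)"
  unfolding nat_trans_def by blast

lemma nat_trans_undefined: "nat_trans C D \<alpha> \<Longrightarrow> a \<notin> Obj C \<Longrightarrow> cmp \<alpha> a = undefined"
  unfolding nat_trans_def extensional_def by blast

text \<open>
  The source category does not occur in most of these conclusions, so the rules are instantiated
  before being handed to the simplifier.
\<close>

lemmas functor_typing = functor_objD functor_arrD

lemmas nat_trans_typing = nat_trans_arrD nat_trans_functorD
  nat_trans_functorD[THEN functor_objD] nat_trans_functorD[THEN functor_arrD(1)]
  nat_trans_functorD[THEN functor_arrD(2)] nat_trans_functorD[THEN functor_arrD(3)]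

lemma nat_transI:
  assumes "is_functor C D (src \<alpha>)" "is_functor C D (trg \<alpha>)"
    and "\<And>a. a \<notin> Obj C \<Longrightarrow> cmp \<alpha> a = undefined"
    and "\<And>a. a \<in> Obj C \<Longrightarrow> cmp \<alpha> a \<in> Arr D"
    and "\<And>a. a \<in> Obj C \<Longrightarrow> Dom D (cmp \<alpha> a) = fob (src \<alpha>) a"
    and "\<And>a. a \<in> Obj C \<Longrightarrow> Cod D (cmp \<alpha> a) = fob (trg \<alpha>) a"
    and "\<And>f. f \<in> Arr C \<Longrightarrow>
      cmp \<alpha> (Cod C f) \<cdot>\<^bsub>D\<^esub> far (src \<alpha>) f = far (trg \<alpha>) f \<cdot>\<^bsub>D\<^esub> cmp \<alpha> (Dom C f)"
  shows "nat_trans C D \<alpha>"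
  using assms unfolding nat_trans_def extensional_def Hom_def by blast

lemma nat_trans_eqI:
  assumes "nat_trans C D \<alpha>" "nat_trans C D \<beta>" "src \<alpha> = src \<beta>" "trg \<alpha> = trg \<beta>"
    and "\<And>a. a \<in> Obj C \<Longrightarrow> cmp \<alpha> a = cmp \<beta> a"
  shows "\<alpha> = \<beta>"
proof -
  have "cmp \<alpha> = cmp \<beta>"
    using nat_trans_undefined[OF assms(1)] nat_trans_undefined[OF assms(2)] assms(5) by (metis ext)
  with assms(3,4) show ?thesis by simp
qed

lemma functor_cat_simps [simp]:
  "Obj (functor_cat C D) = {F. is_functor C D F}"
  "Arr (functor_cat C D) = {\<alpha>. nat_trans C D \<alpha>}"
  "Dom (functor_cat C D) = src"
  "Cod (functor_cat C D) = trg"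
  "src (Ident (functor_cat C D) F) = F"
  "trg (Ident (functor_cat C D) F) = F"
  "a \<in> Obj C \<Longrightarrow> cmp (Ident (functor_cat C D) F) a = Ident D (fob F a)"
  "src (\<beta> \<cdot>\<^bsub>functor_cat C D\<^esub> \<alpha>) = src \<alpha>"
  "trg (\<beta> \<cdot>\<^bsub>functor_cat C D\<^esub> \<alpha>) = trg \<beta>"
  "a \<in> Obj C \<Longrightarrow> cmp (\<beta> \<cdot>\<^bsub>functor_cat C D\<^esub> \<alpha>) a = cmp \<beta> a \<cdot>\<^bsub>D\<^esub> cmp \<alpha> a"
  "a \<notin> Obj C \<Longrightarrow> cmp (Ident (functor_cat C D) F) a = undefined"
  "a \<notin> Obj C \<Longrightarrow> cmp (\<beta> \<cdot>\<^bsub>functor_cat C D\<^esub> \<alpha>) a = undefined"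
  by (simp_all add: functor_cat_def)

lemma comp_functor_simps [simp]:
  "a \<in> Obj C \<Longrightarrow> fob (comp_functor C H F) a = fob H (fob F a)"
  "f \<in> Arr C \<Longrightarrow> far (comp_functor C H F) f = far H (far F f)"
  by (simp_all add: comp_functor_def compose_def)

lemma id_functor_simps [simp]:
  "a \<in> Obj C \<Longrightarrow> fob (id_functor C) a = a"
  "f \<in> Arr C \<Longrightarrow> far (id_functor C) f = f"
  by (simp_all add: id_functor_def)

lemma whisker_left_simps [simp]:
  "src (whisker_left C H \<alpha>) = comp_functor C H (src \<alpha>)"
  "trg (whisker_left C H \<alpha>) = comp_functor C H (trg \<alpha>)"
  "a \<in> Obj C \<Longrightarrow> cmp (whisker_left C H \<alpha>) a = far H (cmp \<alpha> a)"
  "a \<notin> Obj C \<Longrightarrow> cmp (whisker_left C H \<alpha>) a = undefined"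
  by (simp_all add: whisker_left_def)

lemma whisker_right_simps [simp]:
  "src (whisker_right C \<alpha> F) = comp_functor C (src \<alpha>) F"
  "trg (whisker_right C \<alpha> F) = comp_functor C (trg \<alpha>) F"
  "a \<in> Obj C \<Longrightarrow> cmp (whisker_right C \<alpha> F) a = cmp \<alpha> (fob F a)"
  "a \<notin> Obj C \<Longrightarrow> cmp (whisker_right C \<alpha> F) a = undefined"
  by (simp_all add: whisker_right_def)

locale category_pair = C: category C + D: category D
  for C :: "('o, 'm) cat" and D :: "('p, 'n) cat"
begin

lemma ident_nat_trans:
  assumes "is_functor C D F"
  shows "nat_trans C D (Ident (functor_cat C D) F)"
  using assms functor_typing[OF assms]
  by (intro nat_transI) (simp_all add: C.dom_obj C.cod_obj)

lemma comp_nat_trans: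
  assumes \<alpha>: "nat_trans C D \<alpha>" and \<beta>: "nat_trans C D \<beta>" and eq: "trg \<alpha> = src \<beta>"
  shows "nat_trans C D (\<beta> \<cdot>\<^bsub>functor_cat C D\<^esub> \<alpha>)"
proof (rule nat_transI)
  note [simp] = nat_trans_typing[OF \<alpha>] nat_trans_typing[OF \<beta>] eq C.dom_obj C.cod_obj
  fix f
  assume f [simp]: "f \<in> Arr C"
  let ?b = "Cod C f" and ?a = "Dom C f"
  have "(cmp \<beta> ?b \<cdot>\<^bsub>D\<^esub> cmp \<alpha> ?b) \<cdot>\<^bsub>D\<^esub> far (src \<alpha>) f
      = cmp \<beta> ?b \<cdot>\<^bsub>D\<^esub> (cmp \<alpha> ?b \<cdot>\<^bsub>D\<^esub> far (src \<alpha>) f)"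
    by simp
  also have "\<dots> = cmp \<beta> ?b \<cdot>\<^bsub>D\<^esub> (far (src \<beta>) f \<cdot>\<^bsub>D\<^esub> cmp \<alpha> ?a)"
    by (simp only: nat_trans_naturality[OF \<alpha> f] eq)
  also have "\<dots> = (cmp \<beta> ?b \<cdot>\<^bsub>D\<^esub> far (src \<beta>) f) \<cdot>\<^bsub>D\<^esub> cmp \<alpha> ?a"
    by simp
  also have "\<dots> = (far (trg \<beta>) f \<cdot>\<^bsub>D\<^esub> cmp \<beta> ?a) \<cdot>\<^bsub>D\<^esub> cmp \<alpha> ?a"
    by (simp only: nat_trans_naturality[OF \<beta> f])
  also have "\<dots> = far (trg \<beta>) f \<cdot>\<^bsub>D\<^esub> cmp \<beta> ?a \<cdot>\<^bsub>D\<^esub> cmp \<alpha> ?a"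
    by simp
  finally show "cmp (\<beta> \<cdot>\<^bsub>functor_cat C D\<^esub> \<alpha>) ?b \<cdot>\<^bsub>D\<^esub> far (src (\<beta> \<cdot>\<^bsub>functor_cat C D\<^esub> \<alpha>)) f
      = far (trg (\<beta> \<cdot>\<^bsub>functor_cat C D\<^esub> \<alpha>)) f \<cdot>\<^bsub>D\<^esub> cmp (\<beta> \<cdot>\<^bsub>functor_cat C D\<^esub> \<alpha>) ?a"
    by simp
qed (use nat_trans_typing[OF \<alpha>] nat_trans_typing[OF \<beta>] eq in simp_all)

lemma category_functor_cat: "category (functor_cat C D)"
proof
  fix f g h a b c d
  note [simp] = comp_nat_trans ident_nat_trans functor_typing[of C D] nat_trans_typing[of C D]
  assume f: "f \<in> Hom (functor_cat C D) a b"
  { show "Ident (functor_cat C D) b \<cdot>\<^bsub>functor_cat C D\<^esub> f = f"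
      using f by (intro nat_trans_eqI[of C D]) (auto simp: Hom_def)
    show "f \<cdot>\<^bsub>functor_cat C D\<^esub> Ident (functor_cat C D) a = f"
      using f by (intro nat_trans_eqI[of C D]) (auto simp: Hom_def) }
  assume g: "g \<in> Hom (functor_cat C D) b c"
  { show "g \<cdot>\<^bsub>functor_cat C D\<^esub> f \<in> Hom (functor_cat C D) a c"
      using f g by (auto simp: Hom_def) }
  assume h: "h \<in> Hom (functor_cat C D) c d"
  show "(h \<cdot>\<^bsub>functor_cat C D\<^esub> g) \<cdot>\<^bsub>functor_cat C D\<^esub> f
      = h \<cdot>\<^bsub>functor_cat C D\<^esub> (g \<cdot>\<^bsub>functor_cat C D\<^esub> f)"
    using f g h by (intro nat_trans_eqI[of C D]) (auto simp: Hom_def)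
qed (simp_all add: Hom_def ident_nat_trans nat_trans_typing[of C D])

end

context category begin

lemma is_functor_id: "is_functor C C (id_functor C)"
  unfolding is_functor_def
  by (auto simp: dom_obj cod_obj intro!: HomI) (simp_all add: id_functor_def)

lemma is_functor_comp:
  assumes "is_functor C D F" "is_functor D E H"
  shows "is_functor C E (comp_functor C H F)"
  using assms functor_ident[OF assms(1)] functor_ident[OF assms(2)]
    functor_comp[OF assms(1)] functor_comp[OF assms(2)]
    functor_typing[OF assms(1)] functor_typing[OF assms(2)]
  unfolding is_functor_def[of C E]
  by (auto simp: dom_obj cod_obj Hom_def) (auto simp: comp_functor_def)

lemma is_functor_pow: "is_functor C C F \<Longrightarrow> is_functor C C (pow_functor C F n)"
  by (induction n) (auto intro: is_functor_id is_functor_comp)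

lemma comp_functor_assoc:
  assumes "is_functor C D F"
  shows "comp_functor C H (comp_functor C K F) = comp_functor C (comp_functor D H K) F"
  using functor_objD[OF assms] functor_arrD[OF assms]
  by (simp add: comp_functor_def compose_def fun_eq_iff)

lemma comp_id_functor:
  assumes "is_functor C D F"
  shows "comp_functor C (id_functor D) F = F" "comp_functor C F (id_functor C) = F"
  using functor_objD[OF assms] functor_arrD[OF assms] functor_undefined[OF assms]
  by (auto intro!: functor_data.equality simp: comp_functor_def compose_def id_functor_def fun_eq_iff)

lemma nat_trans_whisker_left:
  assumes \<alpha>: "nat_trans C D \<alpha>" and H: "is_functor D E H"
  shows "nat_trans C E (whisker_left C H \<alpha>)"
proof (rule nat_transI)
  note [simp] = nat_trans_typing[OF \<alpha>] functor_typing[OF H] is_functor_comp[OF _ H] dom_obj cod_obj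
  fix f
  assume f [simp]: "f \<in> Arr C"
  have "far H (cmp \<alpha> (Cod C f) \<cdot>\<^bsub>D\<^esub> far (src \<alpha>) f) = far H (far (trg \<alpha>) f \<cdot>\<^bsub>D\<^esub> cmp \<alpha> (Dom C f))"
    by (simp only: nat_trans_naturality[OF \<alpha> f])
  then show "cmp (whisker_left C H \<alpha>) (Cod C f) \<cdot>\<^bsub>E\<^esub> far (src (whisker_left C H \<alpha>)) f
      = far (trg (whisker_left C H \<alpha>)) f \<cdot>\<^bsub>E\<^esub> cmp (whisker_left C H \<alpha>) (Dom C f)"
    by (simp add: functor_comp[OF H])
qed (use nat_trans_typing[OF \<alpha>] functor_typing[OF H] is_functor_comp[OF _ H] in simp_all)

lemma nat_trans_whisker_right:
  assumes \<alpha>: "nat_trans D E \<alpha>" and F: "is_functor C D F"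
  shows "nat_trans C E (whisker_right C \<alpha> F)"
proof (rule nat_transI)
  note [simp] = functor_typing[OF F] dom_obj cod_obj
  fix f
  assume f: "f \<in> Arr C"
  then show "cmp (whisker_right C \<alpha> F) (Cod C f) \<cdot>\<^bsub>E\<^esub> far (src (whisker_right C \<alpha> F)) f
      = far (trg (whisker_right C \<alpha> F)) f \<cdot>\<^bsub>E\<^esub> cmp (whisker_right C \<alpha> F) (Dom C f)"
    using nat_trans_naturality[OF \<alpha>, of "far F f"] by simp
qed (use nat_trans_typing[OF \<alpha>] functor_typing[OF F] is_functor_comp[OF F] in simp_all)

lemma whisker_left_comp_functor:
  assumes "nat_trans C D \<alpha>"
  shows "whisker_left C (comp_functor D H K) \<alpha> = whisker_left C H (whisker_left C K \<alpha>)"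
  using nat_trans_arrD[OF assms] nat_trans_functorD[OF assms]
  by (simp add: whisker_left_def comp_functor_assoc fun_eq_iff)

lemma whisker_left_id:
  assumes "nat_trans C D \<alpha>"
  shows "whisker_left C (id_functor D) \<alpha> = \<alpha>"
  using nat_trans_arrD[OF assms] nat_trans_functorD[OF assms] nat_trans_undefined[OF assms]
  by (auto intro!: trans_data.equality simp: whisker_left_def comp_id_functor fun_eq_iff)

lemma whisker_right_id:
  assumes "nat_trans C D \<alpha>"
  shows "whisker_right C \<alpha> (id_functor C) = \<alpha>"
  using nat_trans_functorD[OF assms] nat_trans_undefined[OF assms]
  by (auto intro!: trans_data.equality simp: whisker_right_def comp_id_functor fun_eq_iff)

lemma whisker_left_pow:
  assumes "nat_trans C C \<alpha>" "is_functor C C H"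
  shows "whisker_left C (pow_functor C H n) \<alpha> = (whisker_left C H ^^ n) \<alpha>"
  by (induction n) (simp_all add: assms whisker_left_id whisker_left_comp_functor)

lemma fob_pow_add:
  assumes "is_functor C C F" "M \<in> Obj C"
  shows "fob (pow_functor C F k) (fob (pow_functor C F m) M) = fob (pow_functor C F (k + m)) M"
  using assms by (induction k) (simp_all add: is_functor_pow functor_objD[of C C])

lemma foldr_comp_hom:
  assumes "set fs \<subseteq> Hom C a a" "a \<in> Obj C"
  shows "foldr (Comp C) fs (Ident C a) \<in> Hom C a a"
  using assms by (induction fs) (auto intro: ident_hom comp_hom)

lemma functor_foldr_comp:
  assumes F: "is_functor C D F" and "set fs \<subseteq> Hom C a a" "a \<in> Obj C"
  shows "far F (foldr (Comp C) fs (Ident C a)) = foldr (Comp D) (map (far F) fs) (Ident D (fob F a))"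
  using assms(2)
proof (induction fs)
  case Nil
  show ?case using functor_ident[OF F] assms(3) by simp
next
  case (Cons f fs)
  then show ?case
    using functor_comp[OF F, of "foldr (Comp C) fs (Ident C a)" f] foldr_comp_hom[of fs a] assms(3)
    by (auto simp: Hom_def)
qed

text \<open>
  This matches the explicit composite with the recursion for \<open>T\<close>: composition on the left with \<open>G\<close>
  turns the list of factors for \<open>n\<close> into the tail of the list for \<open>n + 1\<close>.
\<close>

lemma paracyclic_op_Suc:
  assumes G: "is_functor C C G" and t: "nat_trans C C t"
    "src t = comp_functor C G G" "trg t = comp_functor C G G"
  shows "paracyclic_op C G t (Suc n)
    = whisker_right C t (pow_functor C G n) \<cdot>\<^bsub>End_cat C\<^esub> whisker_left C G (paracyclic_op C G t n)"
proof (rule trans_data.equality)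
  let ?p = "pow_functor C G"
  let ?f = "\<lambda>n M k. far (?p k) (cmp t (fob (?p (n - 1 - k)) M))"
  note [simp] = G is_functor_pow[OF G] fob_pow_add[OF G] t
    functor_typing[of C C] nat_trans_typing[OF t(1)]
  have "foldr (Comp C) (map (?f (Suc n) M) [0..<Suc n]) (Ident C (fob (?p (Suc n + 1)) M))
      = cmp t (fob (?p n) M) \<cdot> far G (foldr (Comp C) (map (?f n M) [0..<n]) (Ident C (fob (?p (n + 1)) M)))"
    if [simp]: "M \<in> Obj C" for M
  proof -
    have typing: "?f n M k \<in> Hom C (fob (?p (n + 1)) M) (fob (?p (n + 1)) M)" if "k < n" for k
    proof (rule HomI)
      have n: "n + 1 = k + Suc (Suc (n - 1 - k))" using that by simp
      have "fob (?p k) (fob G (fob G (fob (?p (n - 1 - k)) M))) = fob (?p (n + 1)) M"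
        unfolding n fob_pow_add[OF G \<open>M \<in> Obj C\<close>, symmetric] by simp
      then show "Dom C (?f n M k) = fob (?p (n + 1)) M" "Cod C (?f n M k) = fob (?p (n + 1)) M"
        by (simp_all del: pow_functor.simps fob_pow_add)
    qed simp
    have "map (?f (Suc n) M) [0..<Suc n] = cmp t (fob (?p n) M) # map (far G) (map (?f n M) [0..<n])"
      by (simp add: upt_conv_Cons map_Suc_upt[symmetric] del: upt_Suc map_Suc_upt)
    then show ?thesis
      using typing by (subst functor_foldr_comp[OF G]) (auto simp del: upt_Suc)
  qed
  then show "cmp (paracyclic_op C G t (Suc n))
     = cmp (whisker_right C t (?p n) \<cdot>\<^bsub>End_cat C\<^esub> whisker_left C G (paracyclic_op C G t n))"
    by (auto simp: paracyclic_op_def functor_cat_def fun_eq_iff simp del: upt_Suc)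
qed (auto simp: paracyclic_op_def comp_functor_assoc[OF is_functor_pow[OF G]] assms)

end

section \<open>The paracyclic structure on the powers of a comonad\<close>

theorem theorem1:
  fixes A :: "('o, 'm) cat"
    and G :: "('o, 'm, 'o, 'm) functor_data"
    and \<delta> \<epsilon> t :: "('o, 'm, 'o, 'm) trans_data"
  assumes comonad: "comonad A G \<delta> \<epsilon>"
    and t_hom: "t \<in> Hom (End_cat A) (comp_functor A G G) (comp_functor A G G)"
    and t_iso: "is_iso (End_cat A) t"
    and i: "\<And>M. M \<in> Obj A \<Longrightarrow> far G (cmp \<epsilon> M) \<cdot>\<^bsub>A\<^esub> cmp t M = cmp \<epsilon> (fob G M)"
    and ii: "\<And>M. M \<in> Obj A \<Longrightarrow> cmp \<epsilon> (fob G M) \<cdot>\<^bsub>A\<^esub> cmp t M = far G (cmp \<epsilon> M)"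
    and iii: "\<And>M. M \<in> Obj A \<Longrightarrow>
      far G (cmp \<delta> M) \<cdot>\<^bsub>A\<^esub> cmp t M
        = cmp t (fob G M) \<cdot>\<^bsub>A\<^esub> far G (cmp t M) \<cdot>\<^bsub>A\<^esub> cmp \<delta> (fob G M)"
    and iv: "\<And>M. M \<in> Obj A \<Longrightarrow>
      cmp \<delta> (fob G M) \<cdot>\<^bsub>A\<^esub> cmp t M
        = cmp t (fob G M) \<cdot>\<^bsub>A\<^esub> far G (cmp t M) \<cdot>\<^bsub>A\<^esub> cmp t (fob G M) \<cdot>\<^bsub>A\<^esub> far G (cmp t M)
            \<cdot>\<^bsub>A\<^esub> far G (cmp \<delta> M)"
    and v: "\<And>M. M \<in> Obj A \<Longrightarrow>
      far G (cmp t M) \<cdot>\<^bsub>A\<^esub> cmp t (fob G M) \<cdot>\<^bsub>A\<^esub> far G (cmp t M)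
        = cmp t (fob G M) \<cdot>\<^bsub>A\<^esub> far G (cmp t M) \<cdot>\<^bsub>A\<^esub> cmp t (fob G M)"
    and vi: "\<And>M. M \<in> Obj A \<Longrightarrow>
      cmp t M \<cdot>\<^bsub>A\<^esub> cmp t M \<cdot>\<^bsub>A\<^esub> cmp t M \<cdot>\<^bsub>A\<^esub> cmp \<delta> M = cmp t M \<cdot>\<^bsub>A\<^esub> cmp \<delta> M"
  shows "augmented_paracyclic_object (End_cat A)
    (comonad_obj A G) (comonad_face A G \<epsilon>) (comonad_degen A G \<delta>)
    (id_functor A) \<epsilon>
    (paracyclic_op A G t)"
proof -
  interpret comonad A G \<delta> \<epsilon> by (rule comonad)
  interpret AA: category_pair A A by unfold_locales
  interpret E: category "End_cat A" by (rule AA.category_functor_cat)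
  note [simp] = functor_typing[of A A] nat_trans_typing[of A A]
    G_functor is_functor_id is_functor_comp[where D = A] is_functor_pow
    nat_trans_whisker_left[where D = A] nat_trans_whisker_right[where D = A]
    AA.comp_nat_trans AA.ident_nat_trans comp_functor_assoc[where D = A]
    comp_id_functor[where D = A] whisker_right_id[where D = A]
  have t [simp]: "nat_trans A A t" "src t = comp_functor A G G" "trg t = comp_functor A G G"
    using t_hom by (auto simp: Hom_def)
  have \<delta> [simp]: "nat_trans A A \<delta>" "src \<delta> = G" "trg \<delta> = comp_functor A G G"
    using \<delta>_hom by (auto simp: Hom_def)
  have \<epsilon> [simp]: "nat_trans A A \<epsilon>" "src \<epsilon> = G" "trg \<epsilon> = id_functor A"
    using \<epsilon>_hom by (auto simp: Hom_def)
  have whisker_iso: "is_iso (End_cat A) (whisker_right A t F)" if [simp]: "is_functor A A F" for F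
  proof -
    obtain u where u: "nat_trans A A u" "src u = comp_functor A G G" "trg u = comp_functor A G G"
      "u \<cdot>\<^bsub>End_cat A\<^esub> t = Ident (End_cat A) (comp_functor A G G)"
      "t \<cdot>\<^bsub>End_cat A\<^esub> u = Ident (End_cat A) (comp_functor A G G)"
      using t_iso by (elim E.is_isoE) auto
    have "cmp u M \<cdot>\<^bsub>A\<^esub> cmp t M = Ident A (fob G (fob G M))"
         "cmp t M \<cdot>\<^bsub>A\<^esub> cmp u M = Ident A (fob G (fob G M))" if "M \<in> Obj A" for M
      using that u(4,5)[THEN arg_cong, of "\<lambda>\<alpha>. cmp \<alpha> M"] by simp_all
    then show ?thesis
      using u(1-3)
      by (intro E.is_isoI[where g = "whisker_right A u F"]) (auto intro!: nat_trans_eqI[of A A])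
  qed
  have naturality: "cmp \<beta> (fob (trg \<alpha>) M) \<cdot>\<^bsub>A\<^esub> far (src \<beta>) (cmp \<alpha> M)
      = far (trg \<beta>) (cmp \<alpha> M) \<cdot>\<^bsub>A\<^esub> cmp \<beta> (fob (src \<alpha>) M)"
    if "nat_trans A A \<beta>" "nat_trans A A \<alpha>" "M \<in> Obj A" for \<alpha> \<beta> M
    using nat_trans_naturality[OF that(1), of "cmp \<alpha> M"] that(2,3) by simp
  \<comment> \<open>Composition on the left with \<open>G\<close> is a comonad on the category of endofunctors.\<close>
  interpret E: paracyclic_comonad_at_object "End_cat A" "comp_functor A G" "whisker_left A G"
    "whisker_right A \<epsilon>" "whisker_right A \<delta>" "id_functor A" "whisker_right A t"
    using coassoc counit_left counit_right i ii iii iv v vi naturality[OF \<epsilon>(1)] naturality[OF \<delta>(1)]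
      naturality[OF t(1)] whisker_iso
    by unfold_locales (auto simp: Hom_def functor_ident functor_comp intro!: nat_trans_eqI[of A A])
  have pow: "(comp_functor A G ^^ n) (id_functor A) = pow_functor A G n" for n
    by (induction n) simp_all
  have "comonad_obj A G = (\<lambda>n. E.P (Suc n))"
    by (simp add: fun_eq_iff comonad_obj_def pow)
  moreover have "comonad_face A G \<epsilon> = E.face"
    by (simp add: fun_eq_iff comonad_face_def E.face_def pow whisker_left_pow)
  moreover have "comonad_degen A G \<delta> = E.degen"
    by (simp add: fun_eq_iff comonad_degen_def E.degen_def pow whisker_left_pow)
  moreover have "paracyclic_op A G t n = E.T n" for n
  proof (induction n)
    case 0
    have "paracyclic_op A G t 0 = Ident (End_cat A) G"
      by (simp add: paracyclic_op_def functor_cat_def)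
    then show ?case by simp
  next
    case (Suc n)
    then show ?case by (simp add: paracyclic_op_Suc pow del: funpow.simps)
  qed
  then have "paracyclic_op A G t = E.T" ..
  moreover have "whisker_right A \<epsilon> (id_functor A) = \<epsilon>" by simp
  ultimately show ?thesis using E.augmented_paracyclic by simp
qed

end
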